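(* Let $\mathbf{C}$ be a category, let $M$ be a metric space whose underlying collection is a set, and let $A\subseteq M$ be a subspace (with the restricted metric). Assume that the $1$-Lipschitz map $g:A\to\mathbf{C}^{\mathbf{R}}_o$ is coherent. If $\mathbf{C}$ is complete or cocomplete, then $g$ admits a coherent $1$-Lipschitz extension $\hat g:M\to\mathbf{C}^{\mathbf{R}}_o$; that is, there is a coherent $1$-Lipschitz map $\hat g:M\to\mathbf{C}^{\mathbf{R}}_o$ with $\hat g|_A=g$.
   Context: Metric spaces: here a metric $d$ is symmetric, satisfies $d(x,x)=0$ and the triangle inequality, may take the value $+\infty$, and may have $d(x,y)=0$ for $x\ne y$. The collection $\mathbf{C}^{\mathbf{R}}_o$ below may be a proper class. A map $f$ is $1$-Lipschitz if $d(f(x),f(y))\le d(x,y)$ for all $x,y$. $\mathbf{R}$ is the poset category of $(\mathbb{R},\le)$. $\mathbf{C}^{\mathbf{R}}$ is the category of functors $\mathbf{R}\to\mathbf{C}$, and $\mathbf{C}^{\mathbf{R}}_o$ is its class of objects. For $e\ge 0$, $T_e:\mathbf{R}\to\mathbf{R}$ is the translation functor $a\mapsto a+e$, and $\sigma_e:1_{\mathbf{R}}\Rightarrow T_e$ is the unique natural transformation. Objects $U,V$ of $\mathbf{C}^{\mathbf{R}}$ are $e$-interleaved if there are natural transformations $\Phi:U\Rightarrow VT_e$ and $\Psi:V\Rightarrow UT_e$ with $(\Psi T_e)\Phi=U\sigma_{2e}$ and $(\Phi T_e)\Psi=V\sigma_{2e}$. $\mathbf{C}^{\mathbf{R}}_o$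 carries the interleaving distance $d_{\mathrm{Int}}(U,V)=\inf\{e\ge0: U,V\text{ are }e\text{-interleaved}\}$ (equal to $\infty$ if there is none). For a metric space $(X,d)$, the spacetime $X\mathbb{R}$ is the set $X\times\mathbb{R}$ with the preorder $(x,s)\le(y,t)\iff d(x,y)\le t-s$, regarded as a thin category (at most one morphism between two objects). For a functor $G:X\mathbb{R}\to\mathbf{C}$, define $\theta(G):X\to\mathbf{C}^{\mathbf{R}}_o$ by sending $x$ to the functor $s\mapsto G(x,s)$, $(s\le t)\mapsto G((x,s)\le(x,t))$. (Equivalently $\theta(G)=G^{\mathbf{R}}\circ\eta_X$, where $\eta_X(x):\mathbf{R}\to X\mathbb{R}$ is $s\mapsto(x,s)$ and $G^{\mathbf{R}}$ is post-composition with $G$.) A $1$-Lipschitz map $g:X\to\mathbf{C}^{\mathbf{R}}_o$ is coherent if $g=\theta(G)$ for some functor $G:X\mathbb{R}\to\mathbf{C}$. A category is complete (cocomplete) if it has all small limits (colimits). *)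

theory Defs
  imports Complex_Main "HOL-Library.Extended_Real" "HOL-Library.FuncSet"
begin

unbundle cardinal_syntax

section \<open>Categories, functors and natural transformations\<close>

record ('o, 'a) cat =
  Obj :: "'o set"
  Arr :: "'a set"
  Dom :: "'a \<Rightarrow> 'o"
  Cod :: "'a \<Rightarrow> 'o"
  Ident :: "'o \<Rightarrow> 'a"
  Comp :: "'a \<Rightarrow> 'a \<Rightarrow> 'a"  \<comment> \<open>\<open>Comp C g f\<close> is "g after f"\<close>

definition Hom :: "('o, 'a) cat \<Rightarrow> 'o \<Rightarrow> 'o \<Rightarrow> 'a set" where
  "Hom C x y = {f \<in> Arr C. Dom C f = x \<and> Cod C f = y}"

definition category :: "('o, 'a) cat \<Rightarrow> bool" where
  "category C \<longleftrightarrow>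
     (\<forall>f \<in> Arr C. Dom C f \<in> Obj C \<and> Cod C f \<in> Obj C) \<and>
     (\<forall>x \<in> Obj C. Ident C x \<in> Hom C x x) \<and>
     (\<forall>f \<in> Arr C. \<forall>g \<in> Arr C. Dom C g = Cod C f \<longrightarrow> Comp C g f \<in> Hom C (Dom C f) (Cod C g)) \<and>
     (\<forall>f \<in> Arr C. Comp C f (Ident C (Dom C f)) = f \<and> Comp C (Ident C (Cod C f)) f = f) \<and>
     (\<forall>f \<in> Arr C. \<forall>g \<in> Arr C. \<forall>h \<in> Arr C. Dom C g = Cod C f \<longrightarrow> Dom C h = Cod C g \<longrightarrow>
        Comp C h (Comp C g f) = Comp C (Comp C h g) f)"

record ('i, 'j, 'o, 'a) func =
  fobj :: "'i \<Rightarrow> 'o"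
  farr :: "'j \<Rightarrow> 'a"

text \<open>
  Both components of a functor are extensional (\<^const>\<open>undefined\<close> off the objects and arrows
  of the source), so that HOL equality of functors is equality on objects and arrows.
\<close>

definition functors :: "('i, 'j) cat \<Rightarrow> ('o, 'a) cat \<Rightarrow> ('i, 'j, 'o, 'a) func set" where
  "functors J C = {F.
     fobj F \<in> Obj J \<rightarrow>\<^sub>E Obj C \<and>
     farr F \<in> Arr J \<rightarrow>\<^sub>E Arr C \<and>
     (\<forall>f \<in> Arr J. farr F f \<in> Hom C (fobj F (Dom J f)) (fobj F (Cod J f))) \<and>
     (\<forall>x \<in> Obj J. farr F (Ident J x) = Ident C (fobj F x)) \<and>
     (\<forall>f \<in> Arr J. \<forall>g \<in> Arr J. Dom J g = Cod J f \<longrightarrow>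
        farr F (Comp J g f) = Comp C (farr F g) (farr F f))}"

text \<open>\<open>func_comp J G F\<close> is the functor "G after F", where \<open>J\<close> is the source of \<open>F\<close>.\<close>

definition func_comp ::
  "('i, 'j) cat \<Rightarrow> ('p, 'q, 'o, 'a) func \<Rightarrow> ('i, 'j, 'p, 'q) func \<Rightarrow> ('i, 'j, 'o, 'a) func" where
  "func_comp J G F =
     \<lparr>fobj = (\<lambda>x \<in> Obj J. fobj G (fobj F x)), farr = (\<lambda>f \<in> Arr J. farr G (farr F f))\<rparr>"

definition nat_trans ::
  "('i, 'j) cat \<Rightarrow> ('o, 'a) cat \<Rightarrow> ('i, 'j, 'o, 'a) func \<Rightarrow> ('i, 'j, 'o, 'a) func
     \<Rightarrow> ('i \<Rightarrow> 'a) \<Rightarrow> bool" where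
  "nat_trans J C F G \<tau> \<longleftrightarrow>
     (\<forall>x \<in> Obj J. \<tau> x \<in> Hom C (fobj F x) (fobj G x)) \<and>
     (\<forall>f \<in> Arr J. Comp C (farr G f) (\<tau> (Dom J f)) = Comp C (\<tau> (Cod J f)) (farr F f))"


section \<open>Limits and colimits; completeness\<close>

definition cone ::
  "('i, 'j) cat \<Rightarrow> ('o, 'a) cat \<Rightarrow> ('i, 'j, 'o, 'a) func \<Rightarrow> 'o \<Rightarrow> ('i \<Rightarrow> 'a) \<Rightarrow> bool" where
  "cone J C F c p \<longleftrightarrow> c \<in> Obj C \<and>
     (\<forall>j \<in> Obj J. p j \<in> Hom C c (fobj F j)) \<and>
     (\<forall>f \<in> Arr J. Comp C (farr F f) (p (Dom J f)) = p (Cod J f))"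

definition limit_cone ::
  "('i, 'j) cat \<Rightarrow> ('o, 'a) cat \<Rightarrow> ('i, 'j, 'o, 'a) func \<Rightarrow> 'o \<Rightarrow> ('i \<Rightarrow> 'a) \<Rightarrow> bool" where
  "limit_cone J C F c p \<longleftrightarrow> cone J C F c p \<and>
     (\<forall>c' p'. cone J C F c' p' \<longrightarrow>
        (\<exists>!h. h \<in> Hom C c' c \<and> (\<forall>j \<in> Obj J. Comp C (p j) h = p' j)))"

definition cocone ::
  "('i, 'j) cat \<Rightarrow> ('o, 'a) cat \<Rightarrow> ('i, 'j, 'o, 'a) func \<Rightarrow> 'o \<Rightarrow> ('i \<Rightarrow> 'a) \<Rightarrow> bool" where
  "cocone J C F c p \<longleftrightarrow> c \<in> Obj C \<and>
     (\<forall>j \<in> Obj J. p j \<in> Hom C (fobj F j) c) \<and>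
     (\<forall>f \<in> Arr J. Comp C (p (Cod J f)) (farr F f) = p (Dom J f))"

definition colimit_cocone ::
  "('i, 'j) cat \<Rightarrow> ('o, 'a) cat \<Rightarrow> ('i, 'j, 'o, 'a) func \<Rightarrow> 'o \<Rightarrow> ('i \<Rightarrow> 'a) \<Rightarrow> bool" where
  "colimit_cocone J C F c p \<longleftrightarrow> cocone J C F c p \<and>
     (\<forall>c' p'. cocone J C F c' p' \<longrightarrow>
        (\<exists>!h. h \<in> Hom C c c' \<and> (\<forall>j \<in> Obj J. Comp C h (p j) = p' j)))"

text \<open>
  Smallness is measured by a cardinal \<open>\<kappa>\<close>: a set is small if its cardinality is below \<open>\<kappa>\<close>.
  Working in a Grothendieck universe amounts to taking for \<open>\<kappa>\<close> the inaccessible cardinal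
  of that universe. Since \<open>\<kappa>\<close> is a well-order on a set of elements of type \<^typ>\<open>'k\<close>, each
  small category is isomorphic to one whose objects and arrows have type \<^typ>\<open>'k\<close>; hence
  index categories on that type suffice.
\<close>

definition small :: "'k rel \<Rightarrow> 'x set \<Rightarrow> bool" where
  "small \<kappa> X \<longleftrightarrow> |X| <o \<kappa>"

definition complete_cat :: "'k rel \<Rightarrow> ('o, 'a) cat \<Rightarrow> bool" where
  "complete_cat \<kappa> C \<longleftrightarrow>
     (\<forall>(J :: ('k, 'k) cat) F. category J \<longrightarrow> small \<kappa> (Obj J) \<longrightarrow> small \<kappa> (Arr J) \<longrightarrow>
        F \<in> functors J C \<longrightarrow> (\<exists>c p. limit_cone J C F c p))"

definition cocomplete_cat :: "'k rel \<Rightarrow> ('o, 'a) cat \<Rightarrow> bool" where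
  "cocomplete_cat \<kappa> C \<longleftrightarrow>
     (\<forall>(J :: ('k, 'k) cat) F. category J \<longrightarrow> small \<kappa> (Obj J) \<longrightarrow> small \<kappa> (Arr J) \<longrightarrow>
        F \<in> functors J C \<longrightarrow> (\<exists>c p. colimit_cocone J C F c p))"


section \<open>The poset of reals and the spacetime of a metric space\<close>

definition thin_cat :: "'x set \<Rightarrow> ('x \<Rightarrow> 'x \<Rightarrow> bool) \<Rightarrow> ('x, 'x \<times> 'x) cat" where
  "thin_cat X le =
     \<lparr>Obj = X, Arr = {(x, y). x \<in> X \<and> y \<in> X \<and> le x y}, Dom = fst, Cod = snd,
      Ident = (\<lambda>x. (x, x)), Comp = (\<lambda>g f. (fst f, snd g))\<rparr>"

definition RR :: "(real, real \<times> real) cat" where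
  "RR = thin_cat UNIV (\<le>)"

text \<open>
  Non-negativity and the exclusion of \<^term>\<open>-\<infinity>\<close> follow from the three conditions.
\<close>

definition ext_metric :: "'m set \<Rightarrow> ('m \<Rightarrow> 'm \<Rightarrow> ereal) \<Rightarrow> bool" where
  "ext_metric X d \<longleftrightarrow>
     (\<forall>x \<in> X. d x x = 0) \<and>
     (\<forall>x \<in> X. \<forall>y \<in> X. d x y = d y x) \<and>
     (\<forall>x \<in> X. \<forall>y \<in> X. \<forall>z \<in> X. d x z \<le> d x y + d y z)"

definition spacetime_le ::
  "('m \<Rightarrow> 'm \<Rightarrow> ereal) \<Rightarrow> 'm \<times> real \<Rightarrow> 'm \<times> real \<Rightarrow> bool" where
  "spacetime_le d p q \<longleftrightarrow> d (fst p) (fst q) \<le> ereal (snd q - snd p)"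

definition spacetime ::
  "'m set \<Rightarrow> ('m \<Rightarrow> 'm \<Rightarrow> ereal) \<Rightarrow> ('m \<times> real, ('m \<times> real) \<times> ('m \<times> real)) cat" where
  "spacetime X d = thin_cat (X \<times> UNIV) (spacetime_le d)"


section \<open>Interleaving distance\<close>

type_synonym ('o, 'a) pers = "(real, real \<times> real, 'o, 'a) func"

definition translation :: "real \<Rightarrow> (real, real \<times> real) pers" where
  "translation e =
     \<lparr>fobj = (\<lambda>a. a + e), farr = (\<lambda>f \<in> Arr RR. (fst f + e, snd f + e))\<rparr>"

definition sigma :: "real \<Rightarrow> real \<Rightarrow> real \<times> real" where
  "sigma e a = (a, a + e)"

text \<open>
  The two equations are those between the natural transformations \<open>(\<Psi> T\<^sub>e) \<Phi> = U \<sigma>\<^sub>2\<^sub>e\<close> and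
  \<open>(\<Phi> T\<^sub>e) \<Psi> = V \<sigma>\<^sub>2\<^sub>e\<close>, written in components.
\<close>

definition interleaved ::
  "('o, 'a) cat \<Rightarrow> real \<Rightarrow> ('o, 'a) pers \<Rightarrow> ('o, 'a) pers \<Rightarrow> bool" where
  "interleaved C e U V \<longleftrightarrow>
     (\<exists>\<Phi> \<Psi>.
        nat_trans RR C U (func_comp RR V (translation e)) \<Phi> \<and>
        nat_trans RR C V (func_comp RR U (translation e)) \<Psi> \<and>
        (\<forall>a. Comp C (\<Psi> (fobj (translation e) a)) (\<Phi> a) = farr U (sigma (2 * e) a)) \<and>
        (\<forall>a. Comp C (\<Phi> (fobj (translation e) a)) (\<Psi> a) = farr V (sigma (2 * e) a)))"

definition d_Int ::
  "('o, 'a) cat \<Rightarrow> ('o, 'a) pers \<Rightarrow> ('o, 'a) pers \<Rightarrow> ereal" where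
  "d_Int C U V = Inf {ereal e | e. 0 \<le> e \<and> interleaved C e U V}"


section \<open>Coherent 1-Lipschitz maps\<close>

definition lipschitz1 ::
  "'m set \<Rightarrow> ('m \<Rightarrow> 'm \<Rightarrow> ereal) \<Rightarrow> ('o, 'a) cat \<Rightarrow> ('m \<Rightarrow> ('o, 'a) pers) \<Rightarrow> bool" where
  "lipschitz1 X d C g \<longleftrightarrow>
     (\<forall>x \<in> X. g x \<in> functors RR C) \<and>
     (\<forall>x \<in> X. \<forall>y \<in> X. d_Int C (g x) (g y) \<le> d x y)"

definition eta :: "'m \<Rightarrow> (real, real \<times> real, 'm \<times> real, ('m \<times> real) \<times> ('m \<times> real)) func" where
  "eta x = \<lparr>fobj = (\<lambda>s. (x, s)), farr = (\<lambda>f \<in> Arr RR. ((x, fst f), (x, snd f)))\<rparr>"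

definition theta ::
  "('m \<times> real, ('m \<times> real) \<times> ('m \<times> real), 'o, 'a) func \<Rightarrow> 'm \<Rightarrow> ('o, 'a) pers" where
  "theta G x = func_comp RR G (eta x)"

definition coherent ::
  "'m set \<Rightarrow> ('m \<Rightarrow> 'm \<Rightarrow> ereal) \<Rightarrow> ('o, 'a) cat \<Rightarrow> ('m \<Rightarrow> ('o, 'a) pers) \<Rightarrow> bool" where
  "coherent X d C g \<longleftrightarrow> (\<exists>G \<in> functors (spacetime X d) C. \<forall>x \<in> X. g x = theta G x)"

end

theory Submission
  imports Defs
begin

text \<open>
  A coherent map \<open>A \<rightarrow> C\<^sup>R\<close> is a functor on the spacetime of \<open>A\<close>, which is a full
  subcategory of the spacetime of \<open>M\<close>, and every map \<open>\<theta>(G)\<close> is automatically 1-Lipschitz: the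
  images under \<open>G\<close> of the morphisms \<open>(x, s) \<le> (y, s + d(x, y))\<close> form an interleaving. So it
  suffices to extend functors along a full inclusion of preorders, which is done by a pointwise
  right Kan extension (the cocomplete case is dual). At a point of the subcategory the value
  itself is a limit, since the comma category there has an initial object; choosing it makes the
  extension strict.
\<close>

section \<open>Categories and functors\<close>

lemma categoryD:
  assumes "category C"
  shows "x \<in> Obj C \<Longrightarrow> Ident C x \<in> Hom C x x"
    and "f \<in> Hom C x y \<Longrightarrow> g \<in> Hom C y z \<Longrightarrow> Comp C g f \<in> Hom C x z"
    and "f \<in> Hom C x y \<Longrightarrow> Comp C f (Ident C x) = f"
    and "f \<in> Hom C x y \<Longrightarrow> Comp C (Ident C y) f = f"
    and "f \<in> Hom C x y \<Longrightarrow> g \<in> Hom C y z \<Longrightarrow> h \<in> Hom C z w \<Longrightarrow>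
      Comp C h (Comp C g f) = Comp C (Comp C h g) f"
  using assms unfolding category_def Hom_def by auto

lemma thin_cat_simps [simp]:
  "Obj (thin_cat X le) = X"
  "(x, y) \<in> Arr (thin_cat X le) \<longleftrightarrow> x \<in> X \<and> y \<in> X \<and> le x y"
  "Dom (thin_cat X le) = fst"
  "Cod (thin_cat X le) = snd"
  "Ident (thin_cat X le) x = (x, x)"
  "Comp (thin_cat X le) u v = (fst v, snd u)"
  by (auto simp: thin_cat_def)

lemma category_thin_cat:
  assumes "reflp_on X le" "transp_on X le"
  shows "category (thin_cat X le)"
  using assms unfolding category_def Hom_def
  by (auto dest: reflp_onD transp_onD)

text \<open>Arrows are related pairs, so functoriality becomes a condition on related pairs and
  chains of three points. That arrows land in \<open>Arr C\<close> already follows from the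
  \<open>Hom\<close> condition, so for \<open>farr F\<close> only extensionality remains of the
  function space.\<close>

lemma functors_thin_cat_iff:
  "F \<in> functors (thin_cat X le) C \<longleftrightarrow>
     fobj F \<in> X \<rightarrow>\<^sub>E Obj C \<and> farr F \<in> extensional (Arr (thin_cat X le)) \<and>
     (\<forall>x \<in> X. \<forall>y \<in> X. le x y \<longrightarrow> farr F (x, y) \<in> Hom C (fobj F x) (fobj F y)) \<and>
     (\<forall>x \<in> X. farr F (x, x) = Ident C (fobj F x)) \<and>
     (\<forall>x \<in> X. \<forall>y \<in> X. \<forall>z \<in> X. le x y \<longrightarrow> le y z \<longrightarrow>
        farr F (x, z) = Comp C (farr F (y, z)) (farr F (x, y)))"
  unfolding functors_def PiE_def
  by (auto simp: Hom_def Ball_def)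

lemma functors_thin_catD:
  assumes "F \<in> functors (thin_cat X le) C"
  shows "x \<in> X \<Longrightarrow> fobj F x \<in> Obj C"
    and "x \<in> X \<Longrightarrow> y \<in> X \<Longrightarrow> le x y \<Longrightarrow> farr F (x, y) \<in> Hom C (fobj F x) (fobj F y)"
    and "x \<in> X \<Longrightarrow> farr F (x, x) = Ident C (fobj F x)"
    and "x \<in> X \<Longrightarrow> y \<in> X \<Longrightarrow> z \<in> X \<Longrightarrow> le x y \<Longrightarrow> le y z \<Longrightarrow>
      Comp C (farr F (y, z)) (farr F (x, y)) = farr F (x, z)"
  using assms unfolding functors_thin_cat_iff by auto

text \<open>The result is \<open>undefined\<close> off \<open>J\<close>, as extensionality demands,
  so that "extends \<open>G\<close>" can be stated as an equation of functors.\<close>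

definition restrict_func ::
  "('x, 'y) cat \<Rightarrow> ('x, 'y, 'o, 'a) func \<Rightarrow> ('x, 'y, 'o, 'a) func" where
  "restrict_func J F = \<lparr>fobj = restrict (fobj F) (Obj J), farr = restrict (farr F) (Arr J)\<rparr>"

text \<open>Reflexivity and transitivity guarantee that the pairs \<open>(x, x)\<close> and
  \<open>(x, z)\<close> in the functor laws are arrows of the subcategory, where the restriction
  keeps the values of \<open>F\<close>.\<close>

lemma restrict_func_in_functors:
  assumes "F \<in> functors (thin_cat X le) C" "Y \<subseteq> X" "reflp_on X le" "transp_on X le"
  shows "restrict_func (thin_cat Y le) F \<in> functors (thin_cat Y le) C"
proof -
  note G = functors_thin_catD[OF assms(1)]
  let ?R = "restrict_func (thin_cat Y le) F"
  have R: "fobj ?R = restrict (fobj F) Y" "farr ?R = restrict (farr F) (Arr (thin_cat Y le))"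
    by (simp_all add: restrict_func_def)
  show ?thesis
    unfolding functors_thin_cat_iff
  proof (intro conjI ballI impI)
    show "fobj ?R \<in> Y \<rightarrow>\<^sub>E Obj C"
      using G(1) assms(2) by (auto simp: R)
    show "farr ?R \<in> extensional (Arr (thin_cat Y le))"
      by (simp add: R)
  next
    fix x y assume "x \<in> Y" "y \<in> Y" "le x y"
    then show "farr ?R (x, y) \<in> Hom C (fobj ?R x) (fobj ?R y)"
      using G(2) assms(2) by (auto simp: R)
  next
    fix x assume "x \<in> Y"
    moreover from this have "x \<in> X" "le x x"
      using assms(2,3) by (auto dest: reflp_onD)
    ultimately show "farr ?R (x, x) = Ident C (fobj ?R x)"
      using G(3) by (simp add: R)
  next
    fix x y z assume Y: "x \<in> Y" "y \<in> Y" "z \<in> Y" and le: "le x y" "le y z"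
    then have X: "x \<in> X" "y \<in> X" "z \<in> X"
      using assms(2) by auto
    then have "le x z"
      using le assms(4) by (meson transp_onD)
    then show "farr ?R (x, z) = Comp C (farr ?R (y, z)) (farr ?R (x, y))"
      using G(4)[OF X le] Y le by (simp add: R)
  qed
qed


section \<open>Limits over small index categories of arbitrary type\<close>

lemma small_subset: "small \<kappa> Y \<Longrightarrow> X \<subseteq> Y \<Longrightarrow> small \<kappa> X"
  unfolding small_def by (meson card_of_mono1 ordLeq_ordLess_trans)

lemma small_image: "small \<kappa> X \<Longrightarrow> small \<kappa> (f ` X)"
  unfolding small_def by (meson card_of_image ordLeq_ordLess_trans)

lemma small_inj:
  assumes "Card_order \<kappa>" "small \<kappa> X"
  obtains i :: "'x \<Rightarrow> 'k" where "inj_on i X" "i ` X \<subseteq> Field \<kappa>"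
proof -
  have "|X| \<le>o |Field \<kappa>|"
    using assms unfolding small_def
    by (meson card_of_Field_ordIso ordIso_symmetric ordLess_imp_ordLeq ordLeq_ordIso_trans)
  then show thesis
    using that unfolding card_of_ordLeq[symmetric] by blast
qed

lemma small_infinite_Field:
  assumes "Card_order \<kappa>" "small \<kappa> X" "infinite X"
  shows "infinite (Field \<kappa>)"
  using small_inj[OF assms(1,2)] assms(3) by (metis finite_imageD finite_subset)

text \<open>A product of two finite sets is finite, hence smaller than the infinite
  \<open>Field \<kappa>\<close>; otherwise the product has at most the cardinality of the larger
  factor, which is infinite.\<close>

lemma small_Times:
  assumes \<kappa>: "Card_order \<kappa>" "infinite (Field \<kappa>)" and X: "small \<kappa> X" and Y: "small \<kappa> Y"
  shows "small \<kappa> (X \<times> Y)"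
proof (cases "finite X \<and> finite Y")
  case True
  then have "|X \<times> Y| <o |Field \<kappa>|"
    using \<kappa>(2) by (meson card_of_Well_order card_of_ordLeq_finite finite_SigmaI not_ordLeq_iff_ordLess)
  then show ?thesis
    unfolding small_def using \<kappa>(1) card_of_Field_ordIso ordLess_ordIso_trans by blast
next
  case False
  consider "|X| \<le>o |Y|" | "|Y| \<le>o |X|"
    using ordLeq_total[OF card_of_Well_order card_of_Well_order] by blast
  then show ?thesis
  proof cases
    case 1
    then have "infinite Y"
      using False card_of_ordLeq_finite by blast
    then have "|X \<times> Y| \<le>o |Y|"
      using 1 by (intro card_of_Sigma_ordLeq_infinite ballI card_of_mono1) auto
    then show ?thesis
      using Y unfolding small_def by (rule ordLeq_ordLess_trans)
  next
    case 2
    then have "infinite X"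
      using False card_of_ordLeq_finite by blast
    then have "|X \<times> Y| \<le>o |X|"
      using 2 by (intro card_of_Sigma_ordLeq_infinite ballI card_of_mono1) auto
    then show ?thesis
      using X unfolding small_def by (rule ordLeq_ordLess_trans)
  qed
qed

text \<open>Completeness speaks only of index categories on the type of \<open>\<kappa>\<close>.
  Smallness gives injections of objects and arrows into that type, along which \<open>J\<close>, the
  diagram and its limit are transported.\<close>

lemma complete_cat_limit:
  fixes J :: "('x, 'y) cat" and \<kappa> :: "'k rel"
  assumes C: "complete_cat \<kappa> C" and \<kappa>: "Card_order \<kappa>"
    and J: "category J" "small \<kappa> (Obj J)" "small \<kappa> (Arr J)" and F: "F \<in> functors J C"
  shows "\<exists>c p. limit_cone J C F c p"
proof -
  obtain i :: "'x \<Rightarrow> 'k" where i: "inj_on i (Obj J)"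
    using small_inj[OF \<kappa> J(2)] by blast
  obtain j :: "'y \<Rightarrow> 'k" where j: "inj_on j (Arr J)"
    using small_inj[OF \<kappa> J(3)] by blast
  define i' where "i' = inv_into (Obj J) i"
  define j' where "j' = inv_into (Arr J) j"
  have i' [simp]: "i' (i x) = x" if "x \<in> Obj J" for x
    using i that by (simp add: i'_def)
  have j' [simp]: "j' (j x) = x" if "x \<in> Arr J" for x
    using j that by (simp add: j'_def)
  \<comment> \<open>The isomorphic copy of \<open>J\<close>: decode by \<open>i'\<close> and
    \<open>j'\<close>, compute in \<open>J\<close>, encode the result by \<open>i\<close> and
    \<open>j\<close>.\<close>
  define K :: "('k, 'k) cat" where
    "K = \<lparr>Obj = i ` Obj J, Arr = j ` Arr J, Dom = (\<lambda>f. i (Dom J (j' f))),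
      Cod = (\<lambda>f. i (Cod J (j' f))), Ident = (\<lambda>x. j (Ident J (i' x))),
      Comp = (\<lambda>g f. j (Comp J (j' g) (j' f)))\<rparr>"
  define F' where
    "F' = \<lparr>fobj = (\<lambda>x \<in> i ` Obj J. fobj F (i' x)), farr = (\<lambda>f \<in> j ` Arr J. farr F (j' f))\<rparr>"
  have K_simps [simp]: "Obj K = i ` Obj J" "Arr K = j ` Arr J"
    "\<And>f. Dom K f = i (Dom J (j' f))" "\<And>f. Cod K f = i (Cod J (j' f))"
    "\<And>x. Ident K x = j (Ident J (i' x))" "\<And>f g. Comp K g f = j (Comp J (j' g) (j' f))"
    by (auto simp: K_def)
  have J_cl [simp]: "Dom J f \<in> Obj J" "Cod J f \<in> Obj J" if "f \<in> Arr J" for f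
    using J(1) that by (auto simp: category_def)
  have J_id [simp]: "Ident J x \<in> Arr J" "Dom J (Ident J x) = x" "Cod J (Ident J x) = x"
    if "x \<in> Obj J" for x
    using J(1) that by (auto simp: category_def Hom_def)
  have J_comp [simp]: "Comp J g f \<in> Arr J" "Dom J (Comp J g f) = Dom J f"
    "Cod J (Comp J g f) = Cod J g"
    if "f \<in> Arr J" "g \<in> Arr J" "Dom J g = Cod J f" for f g
    using J(1) that by (auto simp: category_def Hom_def)
  have i_eq [simp]: "i x = i y \<longleftrightarrow> x = y" if "x \<in> Obj J" "y \<in> Obj J" for x y
    using i that by (auto dest: inj_onD)
  have "category K"
    using J(1) unfolding category_def by (auto simp: Hom_def)
  moreover have "F' \<in> functors K C"
    using F unfolding functors_def F'_def by (auto simp: Hom_def PiE_def Pi_def)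
  ultimately obtain c p where lim: "limit_cone K C F' c p"
    using C J(2,3) small_image K_simps(1,2) unfolding complete_cat_def by metis
  \<comment> \<open>Cones over the copy are cones over \<open>F\<close> with the legs reindexed
    along \<open>i\<close>; the apex stays the same, so the universal property carries over.\<close>
  have cone_iff: "cone K C F' c' p' \<longleftrightarrow> cone J C F c' (p' \<circ> i)" for c' p'
    unfolding cone_def F'_def by auto
  have "\<exists>!h. h \<in> Hom C c' c \<and> (\<forall>x \<in> Obj J. Comp C ((p \<circ> i) x) h = p' x)"
    if "cone J C F c' p'" for c' p'
  proof -
    have "cone K C F' c' (p' \<circ> i')"
      using that unfolding cone_iff by (auto simp: cone_def)
    then have "\<exists>!h. h \<in> Hom C c' c \<and> (\<forall>k \<in> Obj K. Comp C (p k) h = (p' \<circ> i') k)"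
      using lim unfolding limit_cone_def by blast
    then show ?thesis
      by (simp cong: ball_cong)
  qed
  then have "limit_cone J C F c (p \<circ> i)"
    using lim unfolding limit_cone_def cone_iff by blast
  then show ?thesis
    by blast
qed

lemma complete_cat_thin_limit:
  assumes "complete_cat \<kappa> C" "Card_order \<kappa>" "infinite (Field \<kappa>)" "small \<kappa> X"
    and "reflp_on X le" "transp_on X le" "F \<in> functors (thin_cat X le) C"
  shows "\<exists>c p. limit_cone (thin_cat X le) C F c p"
proof (rule complete_cat_limit[OF assms(1,2) category_thin_cat _ _ assms(7)])
  \<comment> \<open>The arrows of a thin category form a subset of
    \<open>X \<times> X\<close>.\<close>
  have "small \<kappa> (X \<times> X)"
    using assms(2-4) by (simp add: small_Times)
  then show "small \<kappa> (Arr (thin_cat X le))"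
    by (rule small_subset) (auto simp: thin_cat_def)
qed (use assms in auto)


section \<open>Extending functors along full inclusions of preorders\<close>

lemma cone_restrict_thin:
  "cone (thin_cat X le) C (restrict_func (thin_cat X le) G) c p \<longleftrightarrow>
     c \<in> Obj C \<and> (\<forall>x \<in> X. p x \<in> Hom C c (fobj G x)) \<and>
     (\<forall>x \<in> X. \<forall>y \<in> X. le x y \<longrightarrow> Comp C (farr G (x, y)) (p x) = p y)"
proof -
  have "(\<forall>u \<in> Arr (thin_cat X le). Comp C (farr G u) (p (fst u)) = p (snd u)) \<longleftrightarrow>
      (\<forall>x \<in> X. \<forall>y \<in> X. le x y \<longrightarrow> Comp C (farr G (x, y)) (p x) = p y)"
    by (auto simp: Ball_def)
  then show ?thesis
    unfolding cone_def restrict_func_def by (auto simp: Ball_def)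
qed

text \<open>The point \<open>b\<close> is initial in its own up-set, so a cone is determined by its
  leg at \<open>b\<close>, and that leg is the mediating morphism.\<close>

lemma limit_cone_up_set:
  assumes C: "category C" and G: "G \<in> functors (thin_cat B le) C"
    and le: "reflp_on B le" and b: "b \<in> B"
  defines "J \<equiv> thin_cat {q \<in> B. le b q} le"
  shows "limit_cone J C (restrict_func J G) (fobj G b) (\<lambda>q. farr G (b, q))"
proof -
  have bb: "le b b"
    using le b by (rule reflp_onD)
  have "cone J C (restrict_func J G) (fobj G b) (\<lambda>q. farr G (b, q))"
    unfolding J_def cone_restrict_thin using b functors_thin_catD[OF G] by auto
  moreover have "\<exists>!h. h \<in> Hom C c' (fobj G b) \<and> (\<forall>q \<in> Obj J. Comp C (farr G (b, q)) h = p' q)"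
    if "cone J C (restrict_func J G) c' p'" for c' p'
  proof (rule ex1I[of _ "p' b"])
    show "p' b \<in> Hom C c' (fobj G b) \<and> (\<forall>q \<in> Obj J. Comp C (farr G (b, q)) (p' b) = p' q)"
      using that b bb unfolding J_def cone_restrict_thin by auto
    fix h assume h: "h \<in> Hom C c' (fobj G b) \<and> (\<forall>q \<in> Obj J. Comp C (farr G (b, q)) h = p' q)"
    then have "p' b = Comp C (farr G (b, b)) h"
      using b bb by (simp add: J_def)
    then show "h = p' b"
      using h functors_thin_catD(3)[OF G b] categoryD(4)[OF C] by metis
  qed
  ultimately show ?thesis
    unfolding limit_cone_def by blast
qed

text \<open>The value at \<open>p\<close> is the limit of \<open>G\<close> over the part of
  \<open>B\<close> above \<open>p\<close>. Arrows between these limits, and the functor laws, come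
  from the universal property.\<close>

lemma right_extension_thin:
  assumes C: "category C" and le: "reflp_on S le" "transp_on S le" and BS: "B \<subseteq> S"
    and G: "G \<in> functors (thin_cat B le) C"
    and lim: "\<And>p. p \<in> S \<Longrightarrow> \<exists>c \<pi>. limit_cone (thin_cat {q \<in> B. le p q} le) C
      (restrict_func (thin_cat {q \<in> B. le p q} le) G) c \<pi>"
  shows "\<exists>H \<in> functors (thin_cat S le) C. restrict_func (thin_cat B le) H = G"
proof -
  define J where "J p = thin_cat {q \<in> B. le p q} le" for p
  define R where "R p = restrict_func (J p) G" for p
  have leB: "reflp_on B le" "transp_on B le"
    using le BS by (auto intro: reflp_on_subset transp_on_subset)
  \<comment> \<open>The limit is fixed on \<open>B\<close>, with the arrows of \<open>G\<close> as
    legs, and arbitrary elsewhere; an arbitrary choice on \<open>B\<close> would give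
    \<open>G\<close> only up to isomorphism.\<close>
  have "\<exists>c \<pi>. limit_cone (J p) C (R p) c \<pi> \<and>
      (p \<in> B \<longrightarrow> c = fobj G p \<and> \<pi> = (\<lambda>q. farr G (p, q)))" if "p \<in> S" for p
  proof (cases "p \<in> B")
    case True
    then show ?thesis
      using limit_cone_up_set[OF C G leB(1)] unfolding J_def R_def by blast
  next
    case False
    then show ?thesis
      using lim[OF that] unfolding J_def R_def by blast
  qed
  then obtain c \<pi> where lim_c: "\<And>p. p \<in> S \<Longrightarrow> limit_cone (J p) C (R p) (c p) (\<pi> p)"
    and c_B: "\<And>p. p \<in> B \<Longrightarrow> c p = fobj G p"
    and \<pi>_B: "\<And>p. p \<in> B \<Longrightarrow> \<pi> p = (\<lambda>q. farr G (p, q))"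
    using BS by (metis subsetD)
  have trans: "le x z" if "le x y" "le y z" "x \<in> S" "y \<in> S" "z \<in> S" for x y z
    using le(2) that by (meson transp_onD)
  have cone_c: "cone (J p) C (R p) (c p) (\<pi> p)" if "p \<in> S" for p
    using lim_c[OF that] by (simp add: limit_cone_def)
  have c_obj: "c p \<in> Obj C" if "p \<in> S" for p
    using cone_c[OF that] by (simp add: cone_def)
  have \<pi>_hom: "\<pi> p q \<in> Hom C (c p) (fobj G q)" if "p \<in> S" "q \<in> B" "le p q" for p q
    using cone_c[OF that(1)] that unfolding J_def R_def cone_restrict_thin by auto
  \<comment> \<open>The morphisms of limits compatible with all legs that the two limits
    share.\<close>
  define is_map where "is_map p p' h \<longleftrightarrow>
    h \<in> Hom C (c p) (c p') \<and> (\<forall>q \<in> B. le p' q \<longrightarrow> Comp C (\<pi> p' q) h = \<pi> p q)" for p p' h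
  have unique: "\<exists>!h. is_map p p' h" if p: "p \<in> S" "p' \<in> S" "le p p'" for p p'
  proof -
    \<comment> \<open>Moving up from \<open>p\<close> to \<open>p'\<close> shrinks the index set, so
      the legs at \<open>p\<close> restrict to a cone over the diagram of \<open>p'\<close>, which
      factors uniquely.\<close>
    have "{q \<in> B. le p' q} \<subseteq> {q \<in> B. le p q}"
      using p BS trans by blast
    then have "cone (J p') C (R p') (c p) (\<pi> p)"
      using cone_c[OF p(1)] unfolding J_def R_def cone_restrict_thin by blast
    then have "\<exists>!h. h \<in> Hom C (c p) (c p') \<and> (\<forall>q \<in> Obj (J p'). Comp C (\<pi> p' q) h = \<pi> p q)"
      using lim_c[OF p(2)] unfolding limit_cone_def by blast
    then show ?thesis
      by (simp add: is_map_def J_def Ball_def imp_conjL)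
  qed
  define h where "h u = (THE h. is_map (fst u) (snd u) h)" for u
  have h_map: "is_map p p' (h (p, p'))" if "p \<in> S" "p' \<in> S" "le p p'" for p p'
    using theI'[OF unique[OF that]] by (simp add: h_def)
  have h_eq: "h (p, p') = k" if "p \<in> S" "p' \<in> S" "le p p'" "is_map p p' k" for p p' k
    using unique[OF that(1-3)] h_map[OF that(1-3)] that(4) by blast
  have h_hom: "h (p, p') \<in> Hom C (c p) (c p')" if "p \<in> S" "p' \<in> S" "le p p'" for p p'
    using h_map[OF that] by (simp add: is_map_def)
  \<comment> \<open>This law, the composition law and the agreement with \<open>G\<close> on
    \<open>B\<close> all follow by uniqueness: the claimed value is itself compatible with the
    legs.\<close>
  have h_id: "h (p, p) = Ident C (c p)" if p: "p \<in> S" for p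
  proof (rule h_eq[OF p p reflp_onD[OF le(1) p]])
    show "is_map p p (Ident C (c p))"
      unfolding is_map_def using categoryD(1,3)[OF C] c_obj \<pi>_hom p by blast
  qed
  have h_comp: "h (x, z) = Comp C (h (y, z)) (h (x, y))"
    if S: "x \<in> S" "y \<in> S" "z \<in> S" and le': "le x y" "le y z" for x y z
  proof (rule h_eq[OF S(1,3) trans[OF le' S]])
    have "Comp C (\<pi> z q) (Comp C (h (y, z)) (h (x, y))) = \<pi> x q" if q: "q \<in> B" "le z q" for q
    proof -
      have "le y q"
        using trans[OF le'(2) q(2)] S q(1) BS by blast
      then show ?thesis
        using categoryD(5)[OF C h_hom[OF S(1,2) le'(1)] h_hom[OF S(2,3) le'(2)] \<pi>_hom[OF S(3) q]]
          h_map[OF S(1,2) le'(1)] h_map[OF S(2,3) le'(2)] q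
        by (simp add: is_map_def)
    qed
    then show "is_map x z (Comp C (h (y, z)) (h (x, y)))"
      unfolding is_map_def
      using categoryD(2)[OF C h_hom[OF S(1,2) le'(1)] h_hom[OF S(2,3) le'(2)]] by blast
  qed
  have h_B: "h (x, y) = farr G (x, y)" if B: "x \<in> B" "y \<in> B" "le x y" for x y
  proof (rule h_eq)
    show "is_map x y (farr G (x, y))"
      unfolding is_map_def using B functors_thin_catD[OF G] by (simp add: c_B \<pi>_B)
  qed (use B BS in auto)
  define H where "H = \<lparr>fobj = restrict c S, farr = restrict h (Arr (thin_cat S le))\<rparr>"
  have fobj_H: "fobj H = restrict c S"
    and farr_H: "farr H = restrict h (Arr (thin_cat S le))"
    by (simp_all add: H_def)
  have farr_H': "farr H (x, y) = h (x, y)" if "x \<in> S" "y \<in> S" "le x y" for x y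
    using that by (simp add: farr_H)
  have "H \<in> functors (thin_cat S le) C"
    unfolding functors_thin_cat_iff
  proof (intro conjI ballI impI)
    show "fobj H \<in> S \<rightarrow>\<^sub>E Obj C"
      using c_obj by (simp add: fobj_H PiE_iff)
    show "farr H \<in> extensional (Arr (thin_cat S le))"
      by (simp add: farr_H)
  next
    fix x y assume "x \<in> S" "y \<in> S" "le x y"
    then show "farr H (x, y) \<in> Hom C (fobj H x) (fobj H y)"
      using h_hom by (simp add: fobj_H farr_H')
  next
    fix x assume "x \<in> S"
    then show "farr H (x, x) = Ident C (fobj H x)"
      using h_id reflp_onD[OF le(1)] by (simp add: fobj_H farr_H')
  next
    fix x y z assume xyz: "x \<in> S" "y \<in> S" "z \<in> S" "le x y" "le y z"
    have "le x z"
      by (rule trans[OF xyz(4,5,1-3)])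
    then show "farr H (x, z) = Comp C (farr H (y, z)) (farr H (x, y))"
      using h_comp[OF xyz] xyz by (simp add: farr_H')
  qed
  moreover have "fobj (restrict_func (thin_cat B le) H) = fobj G"
  proof
    fix x
    have "x \<notin> B \<Longrightarrow> fobj G x = undefined"
      using G by (auto simp: functors_thin_cat_iff)
    then show "fobj (restrict_func (thin_cat B le) H) x = fobj G x"
      using BS by (cases "x \<in> B") (auto simp: restrict_func_def fobj_H c_B)
  qed
  moreover have "farr (restrict_func (thin_cat B le) H) = farr G"
  proof
    fix u
    \<comment> \<open>Off \<open>B\<close> the two sides agree because both are extensional.\<close>
    have "u \<notin> Arr (thin_cat B le) \<Longrightarrow> farr G u = undefined"
      using G unfolding functors_thin_cat_iff extensional_def by blast
    then show "farr (restrict_func (thin_cat B le) H) u = farr G u"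
      using BS by (cases u) (auto simp: restrict_func_def farr_H' h_B subset_iff)
  qed
  ultimately show ?thesis
    by (intro bexI[of _ H] func.equality) auto
qed


section \<open>Duality\<close>

definition op_cat :: "('o, 'a) cat \<Rightarrow> ('o, 'a) cat" where
  "op_cat C = \<lparr>Obj = Obj C, Arr = Arr C, Dom = Cod C, Cod = Dom C, Ident = Ident C,
     Comp = (\<lambda>g f. Comp C f g)\<rparr>"

lemma op_cat_simps [simp]:
  "Obj (op_cat C) = Obj C" "Arr (op_cat C) = Arr C" "Dom (op_cat C) = Cod C"
  "Cod (op_cat C) = Dom C" "Ident (op_cat C) = Ident C" "Comp (op_cat C) g f = Comp C f g"
  by (auto simp: op_cat_def)

lemma Hom_op_cat [simp]: "Hom (op_cat C) x y = Hom C y x"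
  by (auto simp: Hom_def)

lemma op_cat_op_cat: "op_cat (op_cat C) = C"
  by (simp add: op_cat_def)

lemma category_op_cat: "category C \<Longrightarrow> category (op_cat C)"
  unfolding category_def by (auto simp: Hom_def)

text \<open>A functor record stores only the two maps, neither source nor target, so the same record
  serves the opposite categories.\<close>

lemma functors_op_cat: "functors (op_cat J) (op_cat C) = functors J C"
  unfolding functors_def by auto

lemma limit_cone_op_cat: "limit_cone (op_cat J) (op_cat C) F c p \<longleftrightarrow> colimit_cocone J C F c p"
  unfolding limit_cone_def colimit_cocone_def cone_def cocone_def by simp

lemma complete_op_cat:
  assumes "cocomplete_cat \<kappa> C"
  shows "complete_cat \<kappa> (op_cat C)"
  unfolding complete_cat_def
proof (intro allI impI)
  fix J :: "('a, 'a) cat" and F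
  assume J: "category J" "small \<kappa> (Obj J)" "small \<kappa> (Arr J)" and F: "F \<in> functors J (op_cat C)"
  have "F \<in> functors (op_cat J) C"
    using F functors_op_cat[of "op_cat J" C] by (simp add: op_cat_op_cat)
  then have "\<exists>c p. colimit_cocone (op_cat J) C F c p"
    using assms J category_op_cat[OF J(1)] unfolding cocomplete_cat_def by simp
  then show "\<exists>c p. limit_cone J (op_cat C) F c p"
    using limit_cone_op_cat[of "op_cat J" C] by (simp add: op_cat_op_cat)
qed

text \<open>The reversed order gives a thin category isomorphic, but not equal, to the opposite one:
  its arrows are the swapped pairs. Precomposing with the swap bridges this difference.\<close>

definition flip_func ::
  "('x, 'x \<times> 'x, 'o, 'a) func \<Rightarrow> ('x, 'x \<times> 'x, 'o, 'a) func" where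
  "flip_func F = \<lparr>fobj = fobj F, farr = farr F \<circ> prod.swap\<rparr>"

lemma flip_func_flip_func: "flip_func (flip_func F) = F"
  by (simp add: flip_func_def o_assoc[symmetric])

lemma flip_func_in_functors:
  assumes "F \<in> functors (thin_cat X le) C"
  shows "flip_func F \<in> functors (thin_cat X (\<lambda>x y. le y x)) (op_cat C)"
  using assms unfolding functors_thin_cat_iff flip_func_def by (auto simp: extensional_def)

lemma restrict_flip_func:
  "restrict_func (thin_cat X le) (flip_func F) =
     flip_func (restrict_func (thin_cat X (\<lambda>x y. le y x)) F)"
  by (auto simp: restrict_func_def flip_func_def fun_eq_iff)

lemma functor_extension_complete:
  assumes "complete_cat \<kappa> C" "Card_order \<kappa>" "infinite (Field \<kappa>)" "category C"
    and le: "reflp_on S le" "transp_on S le" and S: "small \<kappa> S" "B \<subseteq> S"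
    and G: "G \<in> functors (thin_cat B le) C"
  shows "\<exists>H \<in> functors (thin_cat S le) C. restrict_func (thin_cat B le) H = G"
proof (rule right_extension_thin[OF \<open>category C\<close> le S(2) G])
  fix p
  let ?U = "{q \<in> B. le p q}"
  have "small \<kappa> ?U"
    using S by (auto intro: small_subset)
  moreover have "reflp_on ?U le" "transp_on ?U le"
    using le S(2) by (auto intro: reflp_on_subset transp_on_subset)
  moreover have "reflp_on B le" "transp_on B le"
    using le S(2) by (auto intro: reflp_on_subset transp_on_subset)
  then have "restrict_func (thin_cat ?U le) G \<in> functors (thin_cat ?U le) C"
    using G by (intro restrict_func_in_functors) auto
  ultimately show "\<exists>c \<pi>. limit_cone (thin_cat ?U le) C (restrict_func (thin_cat ?U le) G) c \<pi>"
    by (rule complete_cat_thin_limit[OF assms(1-3)])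
qed

text \<open>Reverse the order, pass to the opposite of \<open>C\<close>, extend there by limits, and
  flip back.\<close>

lemma functor_extension_cocomplete:
  assumes "cocomplete_cat \<kappa> C" "Card_order \<kappa>" "infinite (Field \<kappa>)" "category C"
    and le: "reflp_on S le" "transp_on S le" and S: "small \<kappa> S" "B \<subseteq> S"
    and G: "G \<in> functors (thin_cat B le) C"
  shows "\<exists>H \<in> functors (thin_cat S le) C. restrict_func (thin_cat B le) H = G"
proof -
  have "reflp_on S (\<lambda>x y. le y x)" "transp_on S (\<lambda>x y. le y x)"
    using le unfolding reflp_on_def transp_on_def by blast+
  then obtain H where H: "H \<in> functors (thin_cat S (\<lambda>x y. le y x)) (op_cat C)"
    and HG: "restrict_func (thin_cat B (\<lambda>x y. le y x)) H = flip_func G"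
    using functor_extension_complete[OF complete_op_cat[OF assms(1)] assms(2,3)
        category_op_cat[OF assms(4)] _ _ S flip_func_in_functors[OF G]] by blast
  have "flip_func H \<in> functors (thin_cat S le) C"
    using flip_func_in_functors[OF H] by (simp add: op_cat_op_cat)
  moreover have "restrict_func (thin_cat B le) (flip_func H) = G"
    by (simp add: restrict_flip_func HG flip_func_flip_func)
  ultimately show ?thesis
    by blast
qed


section \<open>Spacetimes and interleavings\<close>

text \<open>Reflexivity is \<open>d x x = 0\<close>; transitivity is the triangle inequality, since
  time differences add up.\<close>

lemma spacetime_le_preorder:
  assumes "ext_metric X d"
  shows "reflp_on (X \<times> UNIV) (spacetime_le d)" "transp_on (X \<times> UNIV) (spacetime_le d)"
proof -
  show "reflp_on (X \<times> UNIV) (spacetime_le d)"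
    using assms by (auto simp: reflp_on_def spacetime_le_def ext_metric_def)
  show "transp_on (X \<times> UNIV) (spacetime_le d)"
  proof (rule transp_onI)
    fix p q r :: "'a \<times> real"
    assume X: "p \<in> X \<times> UNIV" "q \<in> X \<times> UNIV" "r \<in> X \<times> UNIV"
      and le: "spacetime_le d p q" "spacetime_le d q r"
    have "d (fst p) (fst r) \<le> d (fst p) (fst q) + d (fst q) (fst r)"
      using assms X unfolding ext_metric_def by auto
    also have "\<dots> \<le> ereal (snd q - snd p) + ereal (snd r - snd q)"
      using le unfolding spacetime_le_def by (rule add_mono)
    finally show "spacetime_le d p r"
      by (simp add: spacetime_le_def)
  qed
qed

text \<open>The triangle inequality from \<open>x\<close> to \<open>y\<close> and back bounds
  \<open>d x x = 0\<close> by twice the distance.\<close>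

lemma ext_metric_nonneg:
  assumes "ext_metric X d" "x \<in> X" "y \<in> X"
  shows "0 \<le> d x y"
proof -
  have "0 \<le> d x y + d x y"
    using assms unfolding ext_metric_def by metis
  then show ?thesis
    by (cases "d x y") auto
qed

lemma RR_simps [simp]:
  "Obj RR = UNIV" "(s, t) \<in> Arr RR \<longleftrightarrow> s \<le> t" "Dom RR = fst" "Cod RR = snd"
  by (auto simp: RR_def)

lemma theta_simps [simp]:
  "fobj (theta G x) s = fobj G (x, s)"
  "farr (theta G x) = (\<lambda>f \<in> Arr RR. farr G ((x, fst f), (x, snd f)))"
  by (auto simp: theta_def func_comp_def eta_def fun_eq_iff)

lemma theta_in_functors:
  assumes d: "ext_metric X d" and G: "G \<in> functors (spacetime X d) C" and x: "x \<in> X"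
  shows "theta G x \<in> functors RR C"
proof -
  have "d x x = 0"
    using d x by (simp add: ext_metric_def)
  then have "spacetime_le d (x, s) (x, t) \<longleftrightarrow> s \<le> t" for s t
    by (simp add: spacetime_le_def)
  then show ?thesis
    using x functors_thin_catD[OF G[unfolded spacetime_def]]
    unfolding RR_def functors_thin_cat_iff by (auto simp: RR_def)
qed

text \<open>The interleaving maps are the images of the arrows from \<open>(u, a)\<close> to
  \<open>(v, a + e)\<close>. All required equations hold because the spacetime is thin.\<close>

lemma theta_interleaved:
  assumes d: "ext_metric X d" and G: "G \<in> functors (spacetime X d) C"
    and xy: "x \<in> X" "y \<in> X" and e: "d x y = ereal e"
  shows "interleaved C e (theta G x) (theta G y)"
proof -
  have sym: "d y x = ereal e"
    using d xy e unfolding ext_metric_def by metis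
  have e0: "0 \<le> e"
    using ext_metric_nonneg[OF d xy] e by simp
  have zero: "d x x = 0" "d y y = 0"
    using d xy by (auto simp: ext_metric_def)
  note G' = functors_thin_catD[OF G[unfolded spacetime_def]]
  note sle = spacetime_le_def e sym zero
  \<comment> \<open>For \<open>s \<le> t\<close>, both sides of the naturality square are the image
    of the arrow from \<open>(u, s)\<close> to \<open>(v, t + e)\<close>. Stated for general
    \<open>u\<close> and \<open>v\<close> to serve both directions.\<close>
  have nat: "nat_trans RR C (theta G u) (func_comp RR (theta G v) (translation e))
      (\<lambda>a. farr G ((u, a), (v, a + e)))"
    if "u \<in> X" "v \<in> X" "d u v = ereal e" "d u u = 0" "d v v = 0" for u v
    unfolding nat_trans_def using that G'(2,4)
    by (auto simp: func_comp_def translation_def spacetime_le_def)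
  show ?thesis
    unfolding interleaved_def
    using nat[OF xy e zero] nat[OF xy(2,1) sym zero(2,1)] xy e0 G'(4)
    by (intro exI conjI) (assumption, auto simp: translation_def sigma_def sle add.commute)
qed

text \<open>A finite distance is itself an admissible interleaving parameter, hence an upper bound
  for the infimum; an infinite one bounds everything.\<close>

lemma coherent_imp_lipschitz1:
  assumes d: "ext_metric X d" and g: "coherent X d C g"
  shows "lipschitz1 X d C g"
proof -
  obtain G where G: "G \<in> functors (spacetime X d) C" and gG: "\<And>x. x \<in> X \<Longrightarrow> g x = theta G x"
    using g unfolding coherent_def by blast
  have "d_Int C (theta G x) (theta G y) \<le> d x y" if xy: "x \<in> X" "y \<in> X" for x y
  proof (cases "d x y")
    case (real e)
    then have "interleaved C e (theta G x) (theta G y)" "0 \<le> e"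
      using theta_interleaved[OF d G xy] ext_metric_nonneg[OF d xy] by auto
    then show ?thesis
      unfolding d_Int_def real by (intro Inf_lower) auto
  qed (use ext_metric_nonneg[OF d xy] in auto)
  then show ?thesis
    unfolding lipschitz1_def using gG theta_in_functors[OF d G] by simp
qed

theorem theorem3p6:
  fixes C :: "('o, 'a) cat"
    and \<kappa> :: "'k rel"
    and M A :: "'m set"
    and d :: "'m \<Rightarrow> 'm \<Rightarrow> ereal"
    and g :: "'m \<Rightarrow> ('o, 'a) pers"
  assumes "Card_order \<kappa>" and "small \<kappa> (UNIV :: real set)"
    and "category C"
    and "ext_metric M d" and "small \<kappa> M"
    and "A \<subseteq> M"
    and "lipschitz1 A d C g" and "coherent A d C g"
    and "complete_cat \<kappa> C \<or> cocomplete_cat \<kappa> C"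
  shows "\<exists>g_hat. lipschitz1 M d C g_hat \<and> coherent M d C g_hat \<and> (\<forall>x \<in> A. g_hat x = g x)"
proof -
  obtain G where G: "G \<in> functors (spacetime A d) C" and gG: "\<And>x. x \<in> A \<Longrightarrow> g x = theta G x"
    using assms(8) unfolding coherent_def by blast
  \<comment> \<open>The reals form an infinite small set, which forces \<open>\<kappa>\<close> to be
    infinite.\<close>
  have inf: "infinite (Field \<kappa>)"
    using small_infinite_Field[OF assms(1,2)] infinite_UNIV_char_0 by blast
  have small: "small \<kappa> (M \<times> (UNIV :: real set))"
    by (rule small_Times[OF assms(1) inf assms(5,2)])
  have AM: "A \<times> (UNIV :: real set) \<subseteq> M \<times> UNIV"
    using assms(6) by blast
  note pre = spacetime_le_preorder[OF assms(4)]
  obtain H where H: "H \<in> functors (spacetime M d) C"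
    and HG: "restrict_func (spacetime A d) H = G"
    using assms(9) G functor_extension_complete[OF _ assms(1) inf assms(3) pre small AM]
      functor_extension_cocomplete[OF _ assms(1) inf assms(3) pre small AM]
    unfolding spacetime_def by metis
  have coh: "coherent M d C (theta H)"
    using H unfolding coherent_def by blast
  have "theta H x = g x" if x: "x \<in> A" for x
  proof -
    \<comment> \<open>This makes \<open>((x, s), (x, t))\<close> with \<open>s \<le> t\<close> an
      arrow of the spacetime of \<open>A\<close>, so the restriction of \<open>H\<close> to it has
      the same value as \<open>H\<close> there.\<close>
    have "d x x = 0"
      using assms(4,6) x by (auto simp: ext_metric_def)
    then have "theta H x = theta G x"
      using x unfolding HG[symmetric]
      by (auto simp: theta_def func_comp_def eta_def restrict_func_def spacetime_def
          spacetime_le_def fun_eq_iff)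
    then show ?thesis
      using gG[OF x] by simp
  qed
  then show ?thesis
    using coh coherent_imp_lipschitz1[OF assms(4) coh] by blast
qed

end
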